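(* Let $n,m$ be nonnegative integers. There exist uniquely determined polynomials $P$ and $Q$ in one variable $x$ with real coefficients, with $\deg P\leq n$ and $\deg Q\leq m$, such that $$x^{m+1}P(x)+(1-x)^{n+1}Q(x)=1.$$ These polynomials are given by $$P(x)=\sum_{k=0}^n \binom{n+m+1}{k} x^{n-k}(1-x)^k=\sum_{k=0}^n (-1)^k\,\frac{n+m+1}{k+m+1}\binom{n+m}{m}\binom{n}{k}x^k,$$ $$Q(x)=\sum_{k=0}^m \binom{n+m+1}{k}x^k(1-x)^{m-k}=\sum_{k=0}^m\binom{n+k}{k}x^k.$$
   Context: The equation relating $P$ and $Q$ and the displayed formulas are identities of polynomials in $x$. The zero polynomial is regarded as having degree at most any nonnegative integer. *)

theory Defs
  imports Complex_Main "HOL-Computational_Algebra.Polynomial"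
begin

text \<open>The library degree of the zero polynomial is 0, so both bounds admit it.\<close>

definition bezout_pair :: "nat \<Rightarrow> nat \<Rightarrow> real poly \<Rightarrow> real poly \<Rightarrow> bool" where
  "bezout_pair n m P Q \<longleftrightarrow>
     degree P \<le> n \<and> degree Q \<le> m \<and>
     [:0, 1:] ^ (m + 1) * P + (1 - [:0, 1:]) ^ (n + 1) * Q = 1"

end

theory Submission
  imports Defs
begin

text \<open>
  A solution is unique because \<open>x ^ (m + 1)\<close> and \<open>(1 - x) ^ (n + 1)\<close> have no common zero and
  the degree of \<open>Q\<close> is at most \<open>m\<close> (\<open>bezout_pair_unique\<close>). It therefore suffices that each of
  the two closed forms for the pair solves the identity.

  For the Bernstein-type sums this is the binomial theorem: expanding
  \<open>1 = (x + (1 - x)) ^ (n + m + 1)\<close>, the terms whose exponent of \<open>x\<close> exceeds \<open>m\<close> are divisible by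
  \<open>x ^ (m + 1)\<close> and the remaining ones by \<open>(1 - x) ^ (n + 1)\<close>
  (\<open>bezout_pair_bernstein\<close>).

  For the expansions in powers of \<open>x\<close>, the two summands are, up to normalisation, the
  incomplete beta integrals of \<open>t ^ m * (1 - t) ^ n\<close> over \<open>[0, x]\<close> and over \<open>[x, 1]\<close>. So their
  derivatives cancel: the first is the antiderivative obtained by expanding \<open>(1 - t) ^ n\<close>
  termwise, and for the second the derivative telescopes (\<open>pderiv_left_summand\<close>,
  \<open>pderiv_right_summand\<close>). Their sum is constant, and its value at \<open>0\<close> is \<open>1\<close>
  (\<open>bezout_pair_monomial\<close>).
\<close>

text \<open>
  Subtracting two solutions, \<open>x ^ (m + 1)\<close> divides \<open>(1 - x) ^ (n + 1) * (Q - Q')\<close>. Since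
  \<open>1 - x\<close> does not vanish at \<open>0\<close>, the factor \<open>Q - Q'\<close> has a zero of order at least \<open>m + 1\<close>
  there, which its degree forbids unless it is zero.
\<close>

lemma bezout_pair_unique:
  assumes "bezout_pair n m P Q" and "bezout_pair n m P' Q'"
  shows "P = P' \<and> Q = Q'"
proof -
  let ?X = "[:0, 1:] :: real poly"
  have eq: "?X ^ (m + 1) * P + (1 - ?X) ^ (n + 1) * Q = 1"
    and eq': "?X ^ (m + 1) * P' + (1 - ?X) ^ (n + 1) * Q' = 1"
    and deg: "degree Q \<le> m" "degree Q' \<le> m"
    using assms by (auto simp: bezout_pair_def)
  have swap_sides: "a + b = c + d \<Longrightarrow> c - a = b - d" for a b c d :: "real poly"
    by algebra
  have diff: "?X ^ (m + 1) * (P' - P) = (1 - ?X) ^ (n + 1) * (Q - Q')"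
    using trans[OF eq eq'[symmetric]]
    unfolding right_diff_distrib by (rule swap_sides)
  have dvd: "?X ^ (m + 1) dvd (1 - ?X) ^ (n + 1) * (Q - Q')"
    unfolding diff[symmetric] by (rule dvd_triv_left)
  have "Q - Q' = 0"
  proof (rule ccontr)
    assume nz: "Q - Q' \<noteq> 0"
    have at0: "poly ((1 - ?X) ^ (n + 1)) 0 \<noteq> 0" by simp
    then have "(1 - ?X) ^ (n + 1) * (Q - Q') \<noteq> 0"
      using nz by (metis mult_eq_0_iff poly_0)
    then have "m + 1 \<le> order 0 (Q - Q')"
      using dvd order_divides[of 0 "m + 1" "(1 - ?X) ^ (n + 1) * (Q - Q')"] order_0I[OF at0]
      by (simp add: order_mult del: power_Suc mult_eq_0_iff)
    also have "\<dots> \<le> degree (Q - Q')" using nz by (rule order_degree)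
    also have "\<dots> \<le> m" using deg by (rule degree_diff_le)
    finally show False by simp
  qed
  moreover have "P' - P = 0"
    using diff unfolding \<open>Q - Q' = 0\<close> by simp
  ultimately show ?thesis by simp
qed

text \<open>
  In the expansion of \<open>(x + (1 - x)) ^ (n + m + 1)\<close> the upper index range, read backwards,
  contributes the multiple of \<open>x ^ (m + 1)\<close>; this is why both sums run over the initial
  binomial coefficients.
\<close>

lemma bezout_pair_bernstein:
  "bezout_pair n m
     (\<Sum>k=0..n. smult (real ((n + m + 1) choose k)) ([:0, 1:] ^ (n - k) * (1 - [:0, 1:]) ^ k))
     (\<Sum>k=0..m. smult (real ((n + m + 1) choose k)) ([:0, 1:] ^ k * (1 - [:0, 1:]) ^ (m - k)))"
  (is "bezout_pair n m ?P ?Q")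
proof -
  define X where "X = ([:0, 1:] :: real poly)"
  define N where "N = n + m + 1"
  define b where "b k = smult (real (N choose k)) (X ^ k * (1 - X) ^ (N - k))" for k
  have deg: "degree (X ^ i * (1 - X) ^ j) \<le> i + j" for i j
  proof -
    have "degree (X ^ i) \<le> i" "degree ((1 - X) ^ j) \<le> j"
      using degree_power_le[of X i] degree_power_le[of "1 - X" j]
      by (simp_all add: X_def one_pCons)
    then show ?thesis by (meson add_mono degree_mult_le order_trans)
  qed
  have degP: "degree ?P \<le> n"
    unfolding X_def[symmetric]
    by (intro degree_sum_le) (auto intro!: order_trans[OF degree_smult_le] order_trans[OF deg])
  have degQ: "degree ?Q \<le> m"
    unfolding X_def[symmetric]
    by (intro degree_sum_le) (auto intro!: order_trans[OF degree_smult_le] order_trans[OF deg])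
  have "1 = (X + (1 - X)) ^ N" by simp
  also have "\<dots> = (\<Sum>k\<le>N. b k)"
    unfolding binomial_ring b_def by (simp add: of_nat_poly mult.assoc)
  also have "{..N} = {0..m} \<union> {m+1..N}" by (auto simp: N_def)
  also have "sum b \<dots> = sum b {0..m} + sum b {m+1..N}"
    by (rule sum.union_disjoint) auto
  also have "sum b {0..m} = (1 - X) ^ (n + 1) * ?Q"
    unfolding sum_distrib_left X_def[symmetric]
  proof (rule sum.cong)
    fix k assume "k \<in> {0..m}"
    then have "N - k = (n + 1) + (m - k)" by (auto simp: N_def)
    then show "b k = (1 - X) ^ (n + 1) *
        smult (real ((n + m + 1) choose k)) (X ^ k * (1 - X) ^ (m - k))"
      unfolding b_def by (simp only: N_def power_add) (simp add: algebra_simps)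
  qed simp
  also have "sum b {m+1..N} = (\<Sum>k=0..n. b (N - k))"
    by (rule sum.reindex_bij_witness[of _ "\<lambda>k. N - k" "\<lambda>k. N - k"]) (auto simp: N_def)
  also have "\<dots> = X ^ (m + 1) * ?P"
    unfolding sum_distrib_left X_def[symmetric]
  proof (rule sum.cong)
    fix k assume k: "k \<in> {0..n}"
    then have "N - k = (m + 1) + (n - k)" "N - (N - k) = k" "N choose (N - k) = N choose k"
      by (auto simp: N_def binomial_symmetric[symmetric])
    then show "b (N - k) = X ^ (m + 1) *
        smult (real ((n + m + 1) choose k)) (X ^ (n - k) * (1 - X) ^ k)"
      unfolding b_def by (simp only: N_def power_add) (simp add: algebra_simps)
  qed simp
  finally have "X ^ (m + 1) * ?P + (1 - X) ^ (n + 1) * ?Q = 1" by (simp add: add.commute)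
  then show ?thesis unfolding bezout_pair_def X_def by (intro conjI degP degQ)
qed

text \<open>
  The factor \<open>k + m + 1\<close> produced by differentiation cancels the denominator of the
  coefficient, which leaves the binomial expansion of \<open>(1 - x) ^ n\<close>.
\<close>

lemma pderiv_left_summand:
  fixes X :: "real poly"
  defines "X \<equiv> [:0, 1:]"
  shows "pderiv (X ^ (m + 1) *
      (\<Sum>k=0..n. smult ((-1) ^ k * (real (n + m + 1) / real (k + m + 1))
                * real ((n + m) choose m) * real (n choose k)) (X ^ k)))
    = smult (real (n + m + 1) * real ((n + m) choose m)) (X ^ m * (1 - X) ^ n)"
proof -
  define K where "K = real (n + m + 1) * real ((n + m) choose m)"
  define c where "c k = (-1) ^ k * (real (n + m + 1) / real (k + m + 1))
                * real ((n + m) choose m) * real (n choose k)" for k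
  have dX: "pderiv (X ^ Suc j) = smult (real (Suc j)) (X ^ j)" for j
    by (simp only: pderiv_power_Suc) (simp add: X_def pderiv_pCons)
  have term_deriv: "pderiv (X ^ (m + 1) * smult (c k) (X ^ k))
      = X ^ m * smult (K * ((-1) ^ k * real (n choose k))) (X ^ k)" for k
  proof -
    have "X ^ (m + 1) * smult (c k) (X ^ k) = smult (c k) (X ^ Suc (k + m))"
      by (simp add: power_add algebra_simps)
    then have "pderiv (X ^ (m + 1) * smult (c k) (X ^ k))
        = smult (c k * real (Suc (k + m))) (X ^ (k + m))"
      by (simp only: pderiv_smult dX smult_smult)
    moreover have "c k * real (Suc (k + m)) = K * ((-1) ^ k * real (n choose k))"
      unfolding c_def K_def by (simp add: field_simps)
    ultimately show ?thesis by (simp add: power_add algebra_simps)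
  qed
  have "(1 - X) ^ n = (- X + 1) ^ n" by simp
  also have "\<dots> = (\<Sum>k\<le>n. smult ((-1) ^ k * real (n choose k)) (X ^ k))"
    unfolding binomial_ring
  proof (rule sum.cong)
    fix k
    have "(- X) ^ k = smult ((-1) ^ k) (X ^ k)"
      by (metis smult_1_left smult_minus_left smult_power)
    then show "of_nat (n choose k) * (- X) ^ k * 1 ^ (n - k)
        = smult ((-1) ^ k * real (n choose k)) (X ^ k)"
      by (simp add: of_nat_poly mult.commute)
  qed simp
  finally have bin: "(1 - X) ^ n = (\<Sum>k=0..n. smult ((-1) ^ k * real (n choose k)) (X ^ k))"
    by (simp add: atLeast0AtMost)
  have sum_pderiv: "pderiv (\<Sum>k=0..n. f k) = (\<Sum>k=0..n. pderiv (f k))" for f :: "nat \<Rightarrow> real poly"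
    using higher_pderiv_sum[of 1 f "{0..n}"] by simp
  have smult_sum: "smult a (sum f {0..n}) = (\<Sum>k=0..n. smult a (f k))"
    for a and f :: "nat \<Rightarrow> real poly"
    by (rule poly_eqI) (simp add: coeff_sum sum_distrib_left)
  show ?thesis
    unfolding c_def[symmetric] K_def[symmetric] bin sum_distrib_left sum_pderiv term_deriv
      smult_sum by (simp add: mult.assoc)
qed

text \<open>
  Write \<open>Q\<close> for the sum and \<open>dQ\<close> for its derivative; the product rule gives
  \<open>(1 - x) ^ n * ((1 - x) * dQ - (n + 1) * Q)\<close>. With \<open>a k = k * (n + k choose k) * x ^ (k - 1)\<close>,
  absorption yields \<open>a (k + 1) = (n + k + 1) * (n + k choose k) * x ^ k\<close>, so the \<open>k\<close>-th term
  contributes \<open>a k - a (k + 1)\<close> to the second factor and only \<open>- a (m + 1)\<close> survives.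
  The induction on \<open>m\<close> carries out this telescoping.
\<close>

lemma pderiv_right_summand:
  fixes X :: "real poly"
  defines "X \<equiv> [:0, 1:]"
  shows "pderiv ((1 - X) ^ (n + 1) * (\<Sum>k=0..m. smult (real ((n + k) choose k)) (X ^ k)))
    = - smult (real (n + m + 1) * real ((n + m) choose m)) (X ^ m * (1 - X) ^ n)"
proof (induction m)
  have dX: "pderiv (X ^ Suc j) = smult (real (Suc j)) (X ^ j)" for j
    by (simp only: pderiv_power_Suc) (simp add: X_def pderiv_pCons)
  have dY: "pderiv ((1 - X) ^ Suc j) = - smult (real (Suc j)) ((1 - X) ^ j)" for j
    by (simp only: pderiv_power_Suc) (simp add: X_def pderiv_pCons pderiv_diff one_pCons
        smult_minus_left[symmetric]
        del: smult_minus_left)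
  {
    case 0
    show ?case using dY[of n] by simp
  next
    case (Suc m)
    define B where "B = real ((n + Suc m) choose Suc m)"
    have "Suc m * ((n + Suc m) choose Suc m) = (n + m + 1) * ((n + m) choose m)"
      using Suc_times_binomial_eq[of "n + m" m] by (simp add: mult.commute)
    then have absorb: "real (n + m + 1) * real ((n + m) choose m) = real (Suc m) * B"
      unfolding B_def by (metis of_nat_mult)
    have new: "pderiv ((1 - X) ^ Suc n * smult B (X ^ Suc m))
        = smult (B * real (Suc m)) ((1 - X) ^ Suc n * X ^ m)
          - smult (B * real (Suc n)) ((1 - X) ^ n * X ^ Suc m)"
      by (simp only: pderiv_mult pderiv_smult dX dY) (simp add: algebra_simps smult_diff_right)
    have "pderiv ((1 - X) ^ (n + 1) * (\<Sum>k=0..Suc m. smult (real ((n + k) choose k)) (X ^ k)))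
      = - smult (real (Suc m) * B) (X ^ m * (1 - X) ^ n)
        + (smult (B * real (Suc m)) ((1 - X) ^ Suc n * X ^ m)
          - smult (B * real (Suc n)) ((1 - X) ^ n * X ^ Suc m))"
      using Suc.IH[unfolded absorb] new
      by (simp only: sum.atLeast0_atMost_Suc distrib_left pderiv_add B_def[symmetric]
          Suc_eq_plus1[symmetric])
    also have "\<dots> = - smult (B * real (Suc m) + B * real (Suc n)) (X ^ Suc m * (1 - X) ^ n)"
      by (simp add: algebra_simps smult_add_left smult_diff_right del: of_nat_Suc)
    also have "B * real (Suc m) + B * real (Suc n) = real (n + Suc m + 1) * B"
      by (simp add: algebra_simps)
    finally show ?case by (simp only: B_def)
  }
qed

text \<open>
  The two derivatives are opposite, so the left side of the identity is constant; at \<open>0\<close> only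
  the constant coefficient of \<open>Q\<close> contributes.
\<close>

lemma bezout_pair_monomial:
  "bezout_pair n m
     (\<Sum>k=0..n. smult ((-1) ^ k * (real (n + m + 1) / real (k + m + 1))
                * real ((n + m) choose m) * real (n choose k)) ([:0, 1:] ^ k))
     (\<Sum>k=0..m. smult (real ((n + k) choose k)) ([:0, 1:] ^ k))"
  (is "bezout_pair n m ?P ?Q")
proof -
  let ?X = "[:0, 1:] :: real poly"
  let ?S = "?X ^ (m + 1) * ?P + (1 - ?X) ^ (n + 1) * ?Q"
  have deg: "degree (\<Sum>k=0..j. smult (c k) (?X ^ k)) \<le> j" for c and j :: nat
    by (intro degree_sum_le) (auto simp: degree_power_eq intro!: order_trans[OF degree_smult_le])
  have "pderiv ?S = 0"
    by (simp only: pderiv_add pderiv_left_summand pderiv_right_summand add.right_inverse)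
  then obtain c where c: "?S = [:c:]"
    using pderiv_iszero by blast
  have "poly ?Q 0 = (\<Sum>k=0..m. if k = 0 then 1 else 0)"
    unfolding poly_sum by (rule sum.cong) auto
  also have "\<dots> = 1" by simp
  finally have "poly ?S 0 = 1"
    by (simp only: poly_add poly_mult poly_power) simp
  then have "c = 1" unfolding c by simp
  with c have "?S = 1" by (simp only: one_pCons)
  then show ?thesis unfolding bezout_pair_def by (intro conjI deg)
qed

theorem theorem2p1:
  fixes n m :: nat
  shows "(\<exists>!PQ :: real poly \<times> real poly. bezout_pair n m (fst PQ) (snd PQ)) \<and>
    (\<forall>P Q :: real poly. bezout_pair n m P Q \<longrightarrow>
       P = (\<Sum>k=0..n. smult (real ((n + m + 1) choose k))
              ([:0, 1:] ^ (n - k) * (1 - [:0, 1:]) ^ k)) \<and>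
       P = (\<Sum>k=0..n. smult ((-1) ^ k * (real (n + m + 1) / real (k + m + 1))
                * real ((n + m) choose m) * real (n choose k))
              ([:0, 1:] ^ k)) \<and>
       Q = (\<Sum>k=0..m. smult (real ((n + m + 1) choose k))
              ([:0, 1:] ^ k * (1 - [:0, 1:]) ^ (m - k))) \<and>
       Q = (\<Sum>k=0..m. smult (real ((n + k) choose k)) ([:0, 1:] ^ k)))"
proof -
  have "\<exists>!PQ :: real poly \<times> real poly. bezout_pair n m (fst PQ) (snd PQ)"
  proof (rule ex_ex1I)
    show "\<exists>PQ. bezout_pair n m (fst PQ) (snd PQ)"
      by (rule exI[of _ "(_, _)"]) (simp only: fst_conv snd_conv, rule bezout_pair_bernstein)
  next
    fix PQ PQ' :: "real poly \<times> real poly"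
    assume "bezout_pair n m (fst PQ) (snd PQ)" "bezout_pair n m (fst PQ') (snd PQ')"
    then show "PQ = PQ'" unfolding prod_eq_iff by (rule bezout_pair_unique)
  qed
  moreover have "\<forall>P Q. bezout_pair n m P Q \<longrightarrow> P = P' \<and> Q = Q'"
    if "bezout_pair n m P' Q'" for P' Q'
    using bezout_pair_unique[OF _ that] by blast
  note this[OF bezout_pair_bernstein] this[OF bezout_pair_monomial]
  ultimately show ?thesis by fast
qed

end
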